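(* Let $\mathcal{G}$ be a countable family of analytic hypergraphs on a Polish space $X$ such that for some $G\in\mathcal{G}$, $G$ can be written as an increasing countable union $G=\bigcup_nH_n$ of hypergraphs, each with Borel chromatic number two. Then the quotient forcing $P_{I_{\mathcal{G}}}$ adds an independent real.
   Context: For a Polish space $X$, $X^{\leq\omega}$ denotes the space of all finite sequences and all $\omega$-sequences of elements of $X$. A hypergraph on $X$ is a set $G\subset X^{\leq\omega}$; its elements are called edges. $G$ is analytic if it is an analytic subset of $X^{\leq\omega}$. A $G$-anticlique is a set $B\subset X$ with $B^{\leq\omega}\cap G=\emptyset$. The Borel chromatic number of a hypergraph is the smallest cardinality of a collection of Borel anticliques of it covering $X$. For a countable collection $\mathcal{G}$ of hypergraphs on $X$, $I_{\mathcal{G}}$ is the $\sigma$-ideal on $X$ $\sigma$-generated by the Borel sets which are anticliques in at least one of the hypergraphs in $\mathcal{G}$. $P_{I_{\mathcal{G}}}$ is the poset of Borel subsets of $X$ not in $I_{\mathcal{G}}$, ordered by inclusion. A function $x\in 2^\omega$ is an independent real over a model of ZFC if no infinite subfunction of $x$ (restriction of $x$ to an infinite subset of $\omega$) belongs to that model. Adding an independent real means that the extension contains an independent real over the ground model. *)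

theory Defs
  imports "HOL-Analysis.Analysis"
begin

section \<open>Hypergraphs on a space\<close>

text \<open>
  A sequence of length \<open>\<alpha> \<le> \<omega>\<close> is a pair \<open>(\<alpha>, s)\<close> where \<open>s\<close> is a function with domain
  \<open>{i. i < \<alpha>}\<close>, i.e. an extensional function on that set; \<open>\<alpha> = \<infinity>\<close> gives the \<open>\<omega>\<close>-sequences.
\<close>

type_synonym 'a seq_le_omega = "enat \<times> (nat \<Rightarrow> 'a)"

definition seqs_le_omega :: "'a set \<Rightarrow> 'a seq_le_omega set" where
  "seqs_le_omega B = (SIGMA \<alpha>:UNIV. {i. enat i < \<alpha>} \<rightarrow>\<^sub>E B)"

text \<open>The disjoint union of the product spaces \<open>X\<^sup>\<alpha>\<close>, \<open>\<alpha> \<le> \<omega>\<close>.\<close>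

definition seq_topology :: "'a::topological_space seq_le_omega topology" where
  "seq_topology = sum_topology (\<lambda>\<alpha>. product_topology (\<lambda>_. euclidean) {i. enat i < \<alpha>}) UNIV"

lemma topspace_seq_topology: "topspace seq_topology = seqs_le_omega UNIV"
  by (auto simp: seq_topology_def seqs_le_omega_def)

text \<open>
  Analytic subsets of a Polish space: the empty set and the continuous images of the Baire
  space.  The type \<open>nat \<Rightarrow> nat\<close> carries the product of the discrete topologies.
\<close>

definition analytic_in :: "'b topology \<Rightarrow> 'b set \<Rightarrow> bool" where
  "analytic_in T A \<longleftrightarrow>
     A = {} \<or> (\<exists>f. continuous_map (euclidean :: (nat \<Rightarrow> nat) topology) T f \<and> A = range f)"

definition hypergraph :: "'a seq_le_omega set \<Rightarrow> bool" where
  "hypergraph G \<longleftrightarrow> G \<subseteq> seqs_le_omega UNIV"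

definition analytic_hypergraph :: "'a::topological_space seq_le_omega set \<Rightarrow> bool" where
  "analytic_hypergraph G \<longleftrightarrow> hypergraph G \<and> analytic_in seq_topology G"

definition anticlique :: "'a seq_le_omega set \<Rightarrow> 'a set \<Rightarrow> bool" where
  "anticlique G B \<longleftrightarrow> seqs_le_omega B \<inter> G = {}"

definition borel_anticlique_cover ::
    "'a::topological_space seq_le_omega set \<Rightarrow> 'a set set \<Rightarrow> bool" where
  "borel_anticlique_cover G C \<longleftrightarrow> (\<forall>B\<in>C. B \<in> sets borel \<and> anticlique G B) \<and> \<Union>C = UNIV"

text \<open>The Borel chromatic number of \<open>G\<close> exists and equals the cardinality of the set \<open>K\<close>.\<close>

definition has_borel_chromatic_number ::
    "'a::topological_space seq_le_omega set \<Rightarrow> 'k set \<Rightarrow> bool" where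
  "has_borel_chromatic_number G K \<longleftrightarrow>
     (\<exists>C. borel_anticlique_cover G C \<and> C \<approx> K) \<and>
     (\<forall>C. borel_anticlique_cover G C \<longrightarrow> K \<lesssim> C)"


section \<open>The ideal and its quotient forcing\<close>

text \<open>A \<open>\<sigma>\<close>-ideal is not required to be proper.\<close>

definition sigma_ideal :: "'a set set \<Rightarrow> bool" where
  "sigma_ideal J \<longleftrightarrow>
     {} \<in> J \<and>
     (\<forall>A B. A \<in> J \<and> B \<subseteq> A \<longrightarrow> B \<in> J) \<and>
     (\<forall>C. countable C \<and> C \<subseteq> J \<longrightarrow> \<Union>C \<in> J)"

definition hypergraph_ideal ::
    "'a::topological_space seq_le_omega set set \<Rightarrow> 'a set set" where
  "hypergraph_ideal GG = sigma_ideal hull {B \<in> sets borel. \<exists>G\<in>GG. anticlique G B}"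

text \<open>The order of this poset is inclusion, the order \<open>\<le>\<close> of the type of sets.\<close>

definition quotient_forcing :: "'a::topological_space set set \<Rightarrow> 'a set set" where
  "quotient_forcing I = {B \<in> sets borel. B \<notin> I}"


section \<open>Forcing\<close>

text \<open>
  A notion of forcing is a set \<open>P\<close> of conditions in an ordered type; smaller conditions are
  stronger.  The ground model is the ambient universe.  A sentence of the forcing language
  is represented by the predicate ``\<open>p\<close> forces it'' on conditions, and the logical constants
  of the forcing language by the recursion clauses of the forcing relation.  Conjunctions and
  quantifiers over ground model objects are pointwise, hence written with \<open>\<and>\<close> and \<open>\<forall>\<close>.
\<close>

definition dense_below :: "'p::order set \<Rightarrow> 'p \<Rightarrow> ('p \<Rightarrow> bool) \<Rightarrow> bool" where
  "dense_below P p D \<longleftrightarrow> (\<forall>q\<in>P. q \<le> p \<longrightarrow> (\<exists>r\<in>P. r \<le> q \<and> D r))"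

definition forces_not :: "'p::order set \<Rightarrow> 'p \<Rightarrow> ('p \<Rightarrow> bool) \<Rightarrow> bool" where
  "forces_not P p \<phi> \<longleftrightarrow> (\<forall>q\<in>P. q \<le> p \<longrightarrow> \<not> \<phi> q)"

definition forces_ex :: "'p::order set \<Rightarrow> 'p \<Rightarrow> 'n set \<Rightarrow> ('n \<Rightarrow> 'p \<Rightarrow> bool) \<Rightarrow> bool" where
  "forces_ex P p N \<phi> \<longleftrightarrow> dense_below P p (\<lambda>r. \<exists>\<tau>\<in>N. \<phi> \<tau> r)"

text \<open>
  Names for subsets of the ground model set of all elements of type \<open>'x\<close>: a pair \<open>(x, s)\<close>
  stands for the pair of the check name of \<open>x\<close> and the condition \<open>s\<close>, so the value of \<open>\<tau>\<close> in
  the extension by a generic filter \<open>F\<close> is \<open>{x. \<exists>s\<in>F. (x, s) \<in> \<tau>}\<close>.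
\<close>

type_synonym ('x, 'p) name = "('x \<times> 'p) set"

definition names :: "'p set \<Rightarrow> ('x, 'p) name set" where
  "names P = Pow (UNIV \<times> P)"

definition forces_mem :: "'p::order set \<Rightarrow> 'p \<Rightarrow> 'x \<Rightarrow> ('x, 'p) name \<Rightarrow> bool" where
  "forces_mem P p x \<tau> \<longleftrightarrow> dense_below P p (\<lambda>r. \<exists>s. (x, s) \<in> \<tau> \<and> r \<le> s)"

text \<open>\<open>p\<close> forces that \<open>\<tau>\<close> is (the graph of) a function from \<open>\<omega>\<close> to \<open>2\<close>, where \<open>2\<close> is
  represented by \<open>bool\<close>.\<close>

definition forces_in_cantor :: "'p::order set \<Rightarrow> 'p \<Rightarrow> (nat \<times> bool, 'p) name \<Rightarrow> bool" where
  "forces_in_cantor P p \<tau> \<longleftrightarrow>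
     (\<forall>n. forces_ex P p UNIV (\<lambda>i q. forces_mem P q (n, i) \<tau>)) \<and>
     (\<forall>n i j. i \<noteq> j \<longrightarrow>
        forces_not P p (\<lambda>q. forces_mem P q (n, i) \<tau> \<and> forces_mem P q (n, j) \<tau>))"

definition forces_submap ::
    "'p::order set \<Rightarrow> 'p \<Rightarrow> (nat \<rightharpoonup> bool) \<Rightarrow> (nat \<times> bool, 'p) name \<Rightarrow> bool" where
  "forces_submap P p f \<tau> \<longleftrightarrow> (\<forall>n i. f n = Some i \<longrightarrow> forces_mem P p (n, i) \<tau>)"

text \<open>No infinite partial function \<open>f\<close> in the ground model is a subfunction of \<open>\<tau>\<close>.\<close>

definition forces_independent_real ::
    "'p::order set \<Rightarrow> 'p \<Rightarrow> (nat \<times> bool, 'p) name \<Rightarrow> bool" where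
  "forces_independent_real P p \<tau> \<longleftrightarrow>
     forces_in_cantor P p \<tau> \<and>
     (\<forall>f. infinite (dom f) \<longrightarrow> forces_not P p (\<lambda>q. forces_submap P q f \<tau>))"

text \<open>Every condition forces that there is an independent real over the ground model.\<close>

definition adds_independent_real :: "'p::order set \<Rightarrow> bool" where
  "adds_independent_real P \<longleftrightarrow>
     (\<forall>p\<in>P. forces_ex P p (names P) (\<lambda>\<tau> q. forces_independent_real P q \<tau>))"

end

theory Submission
  imports Defs
begin

text \<open>
  Choose Borel sets \<open>A n\<close> such that \<open>A n\<close> and its complement are \<open>H n\<close>-anticliques, and let
  \<open>x\<close> be the name for the real with \<open>x n = True\<close> iff the generic filter contains \<open>A n\<close>.  If a
  condition \<open>q\<close> forces an infinite ground model function \<open>f\<close> to be a subfunction of \<open>x\<close>, then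
  removing from \<open>q\<close> countably many sets of the ideal leaves a condition inside \<open>A n\<close> or its
  complement, as dictated by \<open>f n\<close>, for all \<open>n \<in> dom f\<close>.  This is an anticlique of \<open>H n\<close> for
  infinitely many \<open>n\<close>, hence of the increasing union, and so it belongs to the ideal.
\<close>

text \<open>Each closure condition passes to arbitrary intersections of families satisfying it, and
  the hull is such an intersection.\<close>

lemma sigma_ideal_hull: "sigma_ideal (sigma_ideal hull S)"
proof (rule hull_in)
  fix T :: "'a set set set"
  assume T: "Ball T sigma_ideal"
  show "sigma_ideal (\<Inter>T)"
    unfolding sigma_ideal_def
  proof (intro conjI allI impI)
    show "{} \<in> \<Inter>T"
      using T unfolding sigma_ideal_def by blast
  next
    fix A B assume "A \<in> \<Inter>T \<and> B \<subseteq> A"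
    then show "B \<in> \<Inter>T"
      using T unfolding sigma_ideal_def by blast
  next
    fix C assume "countable C \<and> C \<subseteq> \<Inter>T"
    then have "\<Union>C \<in> J" if "J \<in> T" for J
      using T that by (auto simp: sigma_ideal_def subset_iff)
    then show "\<Union>C \<in> \<Inter>T"
      by (rule InterI)
  qed
qed

lemma seqs_le_omega_mono: "A \<subseteq> B \<Longrightarrow> seqs_le_omega A \<subseteq> seqs_le_omega B"
  unfolding seqs_le_omega_def by (intro Sigma_mono subset_refl PiE_mono)

lemma anticlique_subset: "anticlique G B \<Longrightarrow> A \<subseteq> B \<Longrightarrow> anticlique G A"
  using seqs_le_omega_mono[of A B] unfolding anticlique_def by blast

text \<open>Every index \<open>m\<close> lies below some \<open>n \<in> M\<close>, and then every
  edge of \<open>H m\<close> is an edge of \<open>H n\<close>.\<close>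

lemma anticlique_UN_incseq:
  assumes "incseq H" "infinite M" "\<And>n. n \<in> M \<Longrightarrow> anticlique (H n) B"
  shows "anticlique (\<Union>n. H n) B"
proof -
  have "seqs_le_omega B \<inter> H m = {}" for m
  proof -
    obtain n where "n \<in> M" "m \<le> n"
      using assms(2) by (meson infinite_nat_iff_unbounded_le)
    then show ?thesis
      using assms(1,3) unfolding anticlique_def incseq_def by blast
  qed
  then show ?thesis
    by (auto simp: anticlique_def)
qed

text \<open>A two-element cover \<open>{A, B}\<close> gives \<open>- A \<subseteq> B\<close>, and
  anticliques are inherited by subsets, so the cover can be made a partition.\<close>

lemma borel_chromatic_two_partition:
  assumes "has_borel_chromatic_number G {..<2::nat}"
  obtains A where "A \<in> sets borel" "anticlique G A" "anticlique G (- A)"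
proof -
  obtain C where C: "borel_anticlique_cover G C" "C \<approx> {..<2::nat}"
    using assms by (auto simp: has_borel_chromatic_number_def)
  have "card C = 2"
    using C(2) by (simp add: eqpoll_iff_finite_card)
  then obtain A B where "C = {A, B}"
    by (auto simp: card_2_iff)
  then have AB: "A \<in> sets borel" "anticlique G A" "anticlique G B" "- A \<subseteq> B"
    using C(1) by (auto simp: borel_anticlique_cover_def)
  then show ?thesis
    using anticlique_subset that by blast
qed

text \<open>Names the real taking value \<open>i\<close> at \<open>n\<close> when the generic filter
  contains \<open>A n i\<close>. All conditions inside \<open>A n i\<close> are used because
  \<open>A n i\<close> itself may lie in \<open>I\<close> and fail to be a condition.\<close>

definition indicator_name ::
    "'a::topological_space set set \<Rightarrow> (nat \<Rightarrow> bool \<Rightarrow> 'a set) \<Rightarrow> (nat \<times> bool, 'a set) name" where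
  "indicator_name I A = {((n, i), s) | n i s. s \<in> quotient_forcing I \<and> s \<subseteq> A n i}"

context
  fixes I :: "'a::topological_space set set" and A :: "nat \<Rightarrow> bool \<Rightarrow> 'a set"
  assumes ideal: "sigma_ideal I"
    and borel: "\<And>n i. A n i \<in> sets borel"
begin

lemma sigma_ideal_Un: "B \<in> I \<Longrightarrow> C \<in> I \<Longrightarrow> B \<union> C \<in> I"
proof -
  assume "B \<in> I" "C \<in> I"
  then have "\<Union>{B, C} \<in> I"
    using ideal unfolding sigma_ideal_def
    by (metis countable_empty countable_insert empty_subsetI insert_subset)
  then show ?thesis by simp
qed

lemma sigma_ideal_subset: "B \<in> I \<Longrightarrow> C \<subseteq> B \<Longrightarrow> C \<in> I"
  using ideal unfolding sigma_ideal_def by meson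

lemma forces_mem_indicator_nameI:
  assumes "q \<subseteq> A n i"
  shows "forces_mem (quotient_forcing I) q (n, i) (indicator_name I A)"
  unfolding forces_mem_def dense_below_def
proof (intro ballI impI)
  fix r assume r: "r \<in> quotient_forcing I" "r \<subseteq> q"
  then have "((n, i), r) \<in> indicator_name I A"
    using assms by (simp add: indicator_name_def)
  then show "\<exists>t\<in>quotient_forcing I. t \<subseteq> r \<and> (\<exists>s. ((n, i), s) \<in> indicator_name I A \<and> t \<subseteq> s)"
    using r by blast
qed

text \<open>Otherwise \<open>q - A n i\<close> would be a condition below \<open>q\<close>, and a
  condition below it that also lies inside \<open>A n i\<close> would be empty.\<close>

lemma forces_mem_indicator_nameD:
  assumes "q \<in> quotient_forcing I"
    and "forces_mem (quotient_forcing I) q (n, i) (indicator_name I A)"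
  shows "q - A n i \<in> I"
proof (rule ccontr)
  assume "q - A n i \<notin> I"
  then have "q - A n i \<in> quotient_forcing I"
    using assms(1) borel by (auto simp: quotient_forcing_def intro: sets.Diff)
  moreover have "q - A n i \<subseteq> q"
    by blast
  ultimately obtain r s where "r \<in> quotient_forcing I" "r \<subseteq> q - A n i"
    "((n, i), s) \<in> indicator_name I A" "r \<subseteq> s"
    using assms(2) unfolding forces_mem_def dense_below_def by meson
  then have "r \<in> quotient_forcing I" "r = {}"
    by (auto simp: indicator_name_def)
  then show False
    using ideal by (simp add: quotient_forcing_def sigma_ideal_def)
qed

lemma forces_in_cantor_indicator_name:
  assumes cover: "\<And>n. A n True \<union> A n False = UNIV"
    and disjoint: "\<And>n. A n True \<inter> A n False = {}"
  shows "forces_in_cantor (quotient_forcing I) p (indicator_name I A)"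
  unfolding forces_in_cantor_def
proof (intro conjI allI impI)
  fix n
  show "forces_ex (quotient_forcing I) p UNIV
          (\<lambda>i q. forces_mem (quotient_forcing I) q (n, i) (indicator_name I A))"
    unfolding forces_ex_def dense_below_def
  proof (intro ballI impI)
    fix q assume q: "q \<in> quotient_forcing I"
    \<comment> \<open>The two halves cannot both lie in \<open>I\<close>; one outside
      \<open>I\<close> is a condition deciding the value at \<open>n\<close>.\<close>
    have "q = q \<inter> A n True \<union> q \<inter> A n False"
      using cover[of n] by blast
    then obtain i where "q \<inter> A n i \<notin> I"
      using q sigma_ideal_Un unfolding quotient_forcing_def by (metis (lifting) mem_Collect_eq)
    then have "q \<inter> A n i \<in> quotient_forcing I"
      using q borel by (auto simp: quotient_forcing_def intro: sets.Int)
    then show "\<exists>r\<in>quotient_forcing I. r \<le> q \<and>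
        (\<exists>i\<in>UNIV. forces_mem (quotient_forcing I) r (n, i) (indicator_name I A))"
      using forces_mem_indicator_nameI[of "q \<inter> A n i" n i] by blast
  qed
next
  fix n and i j :: bool assume "i \<noteq> j"
  then have disj: "A n i \<inter> A n j = {}"
    using disjoint[of n] by (cases i; cases j) auto
  show "forces_not (quotient_forcing I) p
          (\<lambda>q. forces_mem (quotient_forcing I) q (n, i) (indicator_name I A) \<and>
               forces_mem (quotient_forcing I) q (n, j) (indicator_name I A))"
    unfolding forces_not_def
  proof (intro ballI impI notI, elim conjE)
    fix q assume q: "q \<in> quotient_forcing I"
      and "forces_mem (quotient_forcing I) q (n, i) (indicator_name I A)"
      and "forces_mem (quotient_forcing I) q (n, j) (indicator_name I A)"
    then have "(q - A n i) \<union> (q - A n j) \<in> I"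
      by (intro sigma_ideal_Un forces_mem_indicator_nameD)
    moreover have "q = (q - A n i) \<union> (q - A n j)"
      using disj by blast
    ultimately show False
      using q by (simp add: quotient_forcing_def)
  qed
qed

text \<open>Uses countable completeness of the ideal: each \<open>n\<close> in the countable set
  \<open>dom f\<close> costs only the set \<open>q - A n (the (f n))\<close> from
  \<open>I\<close>.\<close>

lemma forces_submap_indicator_nameD:
  assumes q: "q \<in> quotient_forcing I"
    and f: "forces_submap (quotient_forcing I) q f (indicator_name I A)"
  shows "q \<inter> (\<Inter>n\<in>dom f. A n (the (f n))) \<in> quotient_forcing I"
proof -
  let ?D = "\<lambda>n. q - A n (the (f n))"
  let ?r = "q \<inter> (\<Inter>n\<in>dom f. A n (the (f n)))"
  have "?D n \<in> I" if "n \<in> dom f" for n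
    using that f forces_mem_indicator_nameD[OF q] by (auto simp: forces_submap_def)
  then have "countable (?D ` dom f) \<and> ?D ` dom f \<subseteq> I"
    by auto
  then have small: "\<Union>(?D ` dom f) \<in> I"
    using ideal unfolding sigma_ideal_def by blast
  have "?r \<notin> I"
  proof
    assume "?r \<in> I"
    then have "?r \<union> \<Union>(?D ` dom f) \<in> I"
      using small by (rule sigma_ideal_Un)
    then have "q \<in> I"
      by (rule sigma_ideal_subset) blast
    then show False
      using q by (simp add: quotient_forcing_def)
  qed
  \<comment> \<open>In this form Borelness follows from countable unions, also when
    \<open>dom f\<close> is empty.\<close>
  moreover have "?r = q - \<Union>(?D ` dom f)"
    by blast
  moreover have "q - \<Union>(?D ` dom f) \<in> sets borel"
    using q borel by (intro sets.Diff sets.countable_UN') (auto simp: quotient_forcing_def)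
  ultimately show ?thesis
    by (simp add: quotient_forcing_def)
qed

end

theorem theorem3p62:
  fixes GG :: "'a::polish_space seq_le_omega set set"
  assumes "countable GG"
    and "\<forall>G\<in>GG. analytic_hypergraph G"
    and "\<exists>G\<in>GG. \<exists>H :: nat \<Rightarrow> 'a seq_le_omega set.
           incseq H \<and> G = (\<Union>n. H n) \<and>
           (\<forall>n. hypergraph (H n) \<and> has_borel_chromatic_number (H n) {..<2::nat})"
  shows "adds_independent_real (quotient_forcing (hypergraph_ideal GG))"
proof -
  let ?I = "hypergraph_ideal GG"
  let ?P = "quotient_forcing ?I"
  obtain G and H :: "nat \<Rightarrow> 'a seq_le_omega set"
    where G: "G \<in> GG" "G = (\<Union>n. H n)" and H: "incseq H"
      "\<And>n. has_borel_chromatic_number (H n) {..<2::nat}"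
    using assms(3) by blast
  have "\<forall>n. \<exists>B. B \<in> sets borel \<and> anticlique (H n) B \<and> anticlique (H n) (- B)"
    using borel_chromatic_two_partition[OF H(2)] by blast
  then obtain B where B: "\<And>n. B n \<in> sets borel"
    "\<And>n. anticlique (H n) (B n)" "\<And>n. anticlique (H n) (- B n)"
    by metis
  \<comment> \<open>Both values of \<open>i\<close> give an \<open>H n\<close>-anticlique, so either
    value that \<open>f\<close> prescribes will do.\<close>
  define A where "A n i = (if i then B n else - B n)" for n i
  have borel: "A n i \<in> sets borel" for n i
    using B(1) by (auto simp: A_def)
  have anti: "anticlique (H n) (A n i)" for n i
    using B(2,3) by (simp add: A_def)
  have ideal: "sigma_ideal ?I"
    unfolding hypergraph_ideal_def by (rule sigma_ideal_hull)
  let ?x = "indicator_name ?I A"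
  have not_submap: "\<not> forces_submap ?P q f ?x" if f: "infinite (dom f)" and q: "q \<in> ?P" for f q
  proof
    assume "forces_submap ?P q f ?x"
    then have r: "q \<inter> (\<Inter>n\<in>dom f. A n (the (f n))) \<in> ?P" (is "?r \<in> _")
      by (rule forces_submap_indicator_nameD[OF ideal borel q])
    \<comment> \<open>\<open>?r\<close> lies inside \<open>A n (the (f n))\<close> for each of the
      infinitely many \<open>n \<in> dom f\<close>.\<close>
    have "anticlique G ?r"
      unfolding G(2) using H(1) f
    proof (rule anticlique_UN_incseq)
      fix n assume "n \<in> dom f"
      then show "anticlique (H n) ?r"
        by (intro anticlique_subset[OF anti]) blast
    qed
    then have "?r \<in> {B \<in> sets borel. \<exists>G\<in>GG. anticlique G B}"
      using G(1) r unfolding quotient_forcing_def by blast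
    then have "?r \<in> ?I"
      unfolding hypergraph_ideal_def by (rule hull_inc)
    then show False
      using r by (simp add: quotient_forcing_def)
  qed
  have "forces_in_cantor ?P q ?x" for q
    by (rule forces_in_cantor_indicator_name[OF ideal borel]) (auto simp: A_def)
  then have "forces_independent_real ?P q ?x" for q
    using not_submap by (simp add: forces_independent_real_def forces_not_def)
  moreover have "?x \<in> names ?P"
    by (auto simp: indicator_name_def names_def)
  \<comment> \<open>The single name \<open>?x\<close> works for every condition, so each condition
    is its own witness to density.\<close>
  ultimately show ?thesis
    unfolding adds_independent_real_def forces_ex_def dense_below_def by blast
qed

end
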